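(* Let $S$ be a skip graph with alphabet $\{0,1\}$, and consider a search from node $s$ to node $t$ in $S$. Let $u$ be a node with $s < u < t$ in the key ordering, and let $d$ be the number of nodes $v$ with $u < v \le t$. Then the probability that the search from $s$ to $t$ passes through $u$ is less than $\frac{2}{d+1}$.
   Context: Skip graph: a finite set of nodes with distinct keys from a totally ordered set; each node $x$ has a membership vector $m(x)\in\{0,1\}^\omega$ whose bits are independent and uniformly random. For each finite binary word $w$, $S_w$ is the list of nodes whose membership vector has prefix $w$, sorted by key; $w\upharpoonright i$ is the length-$i$ prefix of $w$. Search from $s$ to $t$ (with $s<t$): the search keeps a current node $v$ (initially $s$) and a current level $\ell$ (initially the least level at which $s$ is alone in $S_{m(s)\upharpoonright\ell}$); repeatedly, if the successor of $v$ in the list $S_{m(s)\upharpoonright \ell}$ exists and has key $\le t$, the search moves to that successor; otherwise, if $\ell>0$ it decreases $\ell$ by one, and if $\ell=0$ it stops. The search passes through $u$ if $u$ is one of the current nodes visited. The probability is over the random membership vectors. *)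

theory Defs
  imports "HOL-Probability.Probability"
begin

text \<open>
  A skip graph is given by a finite node set \<open>V\<close>, a key function \<open>key\<close> that is injective on \<open>V\<close>,
  and membership vectors \<open>m x :: nat \<Rightarrow> bool\<close>; \<open>bool\<close> plays the role of the alphabet \<open>{0,1}\<close>.
\<close>

definition vec_prefix :: "nat \<Rightarrow> (nat \<Rightarrow> bool) \<Rightarrow> bool list" where
  "vec_prefix l f = map f [0..<l]"

definition skip_list ::
  "'n set \<Rightarrow> ('n \<Rightarrow> 'k::linorder) \<Rightarrow> ('n \<Rightarrow> nat \<Rightarrow> bool) \<Rightarrow> bool list \<Rightarrow> 'n list" where
  "skip_list V key m w = sorted_key_list_of_set key {x \<in> V. vec_prefix (length w) (m x) = w}"

fun list_successor :: "'a list \<Rightarrow> 'a \<Rightarrow> 'a option" where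
  "list_successor (x # y # xs) v = (if x = v then Some y else list_successor (y # xs) v)"
| "list_successor _ v = None"

text \<open>
  If no level isolates \<open>s\<close> (for independent uniform bits this is a null event), the value below is
  an unspecified natural number.
\<close>

definition start_level ::
  "'n set \<Rightarrow> ('n \<Rightarrow> 'k::linorder) \<Rightarrow> ('n \<Rightarrow> nat \<Rightarrow> bool) \<Rightarrow> 'n \<Rightarrow> nat" where
  "start_level V key m s = (LEAST l. skip_list V key m (vec_prefix l (m s)) = [s])"

text \<open>
  \<open>search_state V key m s t v l\<close>: at some point of the search from \<open>s\<close> to \<open>t\<close>, the current node is
  \<open>v\<close> and the current level is \<open>l\<close>. The rules \<open>move\<close> and \<open>descend\<close> are mutually exclusive, so these
  are exactly the configurations of one deterministic run; neither rule applies in its last one.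
\<close>

inductive search_state ::
  "'n set \<Rightarrow> ('n \<Rightarrow> 'k::linorder) \<Rightarrow> ('n \<Rightarrow> nat \<Rightarrow> bool) \<Rightarrow> 'n \<Rightarrow> 'n \<Rightarrow> 'n \<Rightarrow> nat \<Rightarrow> bool"
  for V key m s t where
  start: "search_state V key m s t s (start_level V key m s)"
| move: "search_state V key m s t v' l"
    if "search_state V key m s t v l"
      and "list_successor (skip_list V key m (vec_prefix l (m s))) v = Some v'"
      and "key v' \<le> key t"
| descend: "search_state V key m s t v l"
    if "search_state V key m s t v (Suc l)"
      and "\<not> (\<exists>v'. list_successor (skip_list V key m (vec_prefix (Suc l) (m s))) v = Some v'
                \<and> key v' \<le> key t)"

definition passes_through ::
  "'n set \<Rightarrow> ('n \<Rightarrow> 'k::linorder) \<Rightarrow> ('n \<Rightarrow> nat \<Rightarrow> bool) \<Rightarrow> 'n \<Rightarrow> 'n \<Rightarrow> 'n \<Rightarrow> bool" where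
  "passes_through V key m s t u \<longleftrightarrow> (\<exists>l. search_state V key m s t u l)"

end

theory Submission
  imports Defs
begin

text \<open>
  For a node \<open>x\<close> let \<open>c x\<close> be the length of the longest common prefix of its membership vector with
  that of \<open>s\<close>. Level \<open>l\<close> of the search exhausts the nodes with \<open>c \<ge> l\<close> up to \<open>t\<close>, so \<open>u\<close> is only
  visited if \<open>c u \<ge> c v\<close> for each of the \<open>d\<close> nodes \<open>v\<close> between \<open>u\<close> and \<open>t\<close>. The values \<open>c x\<close> are
  independent and geometric, hence the probability of this is the sum over \<open>k\<close> of \<open>q (1 - q)^d\<close> with
  \<open>q = 2^-(k+1)\<close>. As \<open>q (1 - q)^d\<close> is at most twice the integral of \<open>(1 - x)^d\<close> over \<open>[q/2, q]\<close>,
  the sum is at most twice the integral over \<open>[0, 1/2]\<close>, which is less than \<open>2 / (d + 1)\<close>.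
\<close>

section \<open>The search\<close>

lemma list_successor_greater:
  fixes key :: "'a \<Rightarrow> 'k::linorder"
  assumes "sorted_wrt (<) (map key xs)" "list_successor xs v = Some v'"
  shows "v' \<in> set xs" "key v < key v'"
  using assms by (induction xs v rule: list_successor.induct) (auto split: if_splits)

lemma list_successor_le:
  fixes key :: "'a \<Rightarrow> 'k::linorder"
  assumes "sorted_wrt (<) (map key xs)" "v \<in> set xs" "x \<in> set xs" "key v < key x"
  shows "\<exists>v'. list_successor xs v = Some v' \<and> key v' \<le> key x"
  using assms by (induction xs v rule: list_successor.induct) fastforce+

lemma vec_prefix_eq_iff: "vec_prefix l f = vec_prefix l g \<longleftrightarrow> (\<forall>i<l. f i = g i)"
  by (auto simp: vec_prefix_def)

lemma length_vec_prefix [simp]: "length (vec_prefix l f) = l"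
  by (simp add: vec_prefix_def)

text \<open>Taking \<open>A\<close> itself as the carrier of the locale reduces its assumption to
  injectivity of \<open>f\<close> on \<open>A\<close>, which also makes the order of the keys
  strict.\<close>

lemma (in linorder)
  assumes "finite A" "inj_on f A"
  shows set_sorted_key_list_of_set_inj_on: "set (sorted_key_list_of_set f A) = A"
    and strict_sorted_key_list_of_set_inj_on:
      "sorted_wrt (<) (map f (sorted_key_list_of_set f A))"
proof -
  interpret folding_insort_key "(\<le>)" "(<)" A f
    by unfold_locales fact
  show "set (sorted_key_list_of_set f A) = A"
    using assms(1) by simp
  show "sorted_wrt (<) (map f (sorted_key_list_of_set f A))"
    by simp
qed

lemma
  assumes "finite V" "inj_on key V"
  shows set_skip_list: "set (skip_list V key m w) = {x \<in> V. vec_prefix (length w) (m x) = w}"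
    and sorted_skip_list: "sorted_wrt (<) (map key (skip_list V key m w))"
proof -
  let ?A = "{x \<in> V. vec_prefix (length w) (m x) = w}"
  have A: "finite ?A" "inj_on key ?A"
    using assms by (auto intro: inj_on_subset)
  show "set (skip_list V key m w) = ?A"
    unfolding skip_list_def by (rule set_sorted_key_list_of_set_inj_on[OF A])
  show "sorted_wrt (<) (map key (skip_list V key m w))"
    unfolding skip_list_def by (rule strict_sorted_key_list_of_set_inj_on[OF A])
qed

text \<open>The search invariant. At the start, \<open>s\<close> is already alone at level
  \<open>l\<close>; a move only shrinks the range of keys beyond \<open>v\<close>; a descent happens
  because the level just left has no successor of \<open>v\<close> up to \<open>t\<close>. The
  assumption \<open>isolated\<close> makes the start level a genuine one.\<close>

lemma search_state_unvisited:
  assumes "finite V" "inj_on key V" "s \<in> V"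
    and isolated: "\<exists>l. \<forall>x\<in>V - {s}. vec_prefix l (m x) \<noteq> vec_prefix l (m s)"
    and "search_state V key m s t v l"
  shows "v \<in> V \<and> vec_prefix l (m v) = vec_prefix l (m s) \<and>
    (\<forall>x\<in>V. key v < key x \<longrightarrow> key x \<le> key t \<longrightarrow>
      vec_prefix (Suc l) (m x) \<noteq> vec_prefix (Suc l) (m s))"
  using assms(5)
proof induction
  case start
  obtain l where l: "\<forall>x\<in>V - {s}. vec_prefix l (m x) \<noteq> vec_prefix l (m s)"
    using isolated by blast
  have "set (skip_list V key m (vec_prefix l (m s))) = {s}"
    using l assms(3) by (auto simp: set_skip_list[OF assms(1,2)])
  \<comment> \<open>\<open>start_level\<close> asks for the list \<open>[s]\<close>, so the node set
    \<open>{s}\<close> has to be supplemented by distinctness. The witness \<open>l\<close> then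
    shows that the \<open>LEAST\<close> is attained.\<close>
  moreover have "distinct (skip_list V key m (vec_prefix l (m s)))"
    using sorted_skip_list[OF assms(1,2)] strict_sorted_iff distinct_map by blast
  ultimately have "skip_list V key m (vec_prefix l (m s)) = [s]"
    by (metis distinct.simps(2) list.set_intros(1) list.set_intros(2) list.exhaust
        list.set(1) singletonD insert_not_empty)
  then have "skip_list V key m (vec_prefix (start_level V key m s) (m s)) = [s]"
    unfolding start_level_def by (rule LeastI)
  then have *: "{x \<in> V. vec_prefix (start_level V key m s) (m x) =
      vec_prefix (start_level V key m s) (m s)} = {s}"
    using set_skip_list[OF assms(1,2), of m "vec_prefix (start_level V key m s) (m s)"] by simp
  show ?case
    using * assms(3) by (fastforce simp: vec_prefix_eq_iff)
next
  case (move v l v')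
  note successor = list_successor_greater[OF sorted_skip_list[OF assms(1,2)] move.hyps(2)]
  from successor(1) have "v' \<in> V" "vec_prefix l (m v') = vec_prefix l (m s)"
    by (simp_all add: set_skip_list[OF assms(1,2)])
  then show ?case
    using move.IH successor(2) by auto
next
  case (descend v l)
  have "vec_prefix (Suc l) (m x) \<noteq> vec_prefix (Suc l) (m s)"
    if "x \<in> V" "key v < key x" "key x \<le> key t" for x
  proof
    assume "vec_prefix (Suc l) (m x) = vec_prefix (Suc l) (m s)"
    then have "\<exists>v'. list_successor (skip_list V key m (vec_prefix (Suc l) (m s))) v = Some v'
        \<and> key v' \<le> key x"
      using descend.IH that
      by (intro list_successor_le sorted_skip_list assms) (auto simp: set_skip_list[OF assms(1,2)])
    then show False
      using descend.hyps(2) that(3) by force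
  qed
  then show ?case
    using descend.IH by (auto simp: vec_prefix_eq_iff)
qed

text \<open>If \<open>u\<close> is visited at level \<open>l\<close>, it agrees with
  \<open>s\<close> on \<open>l\<close> bits, so its first disagreement \<open>k\<close> is at least
  \<open>l\<close>; the nodes beyond \<open>u\<close> differ from \<open>s\<close> within
  \<open>Suc l\<close>, hence within \<open>Suc k\<close> bits. This trades the level of the search
  for \<open>k\<close>, which depends on the vectors alone, and \<open>k < K\<close> leaves finitely
  many cases.\<close>

lemma passes_through_agreement:
  assumes "finite V" "inj_on key V" "s \<in> V" "u \<in> V" "u \<noteq> s"
    and isolated: "\<forall>x\<in>V - {s}. vec_prefix K (m x) \<noteq> vec_prefix K (m s)"
    and "passes_through V key m s t u"
  shows "\<exists>k<K. vec_prefix k (m u) = vec_prefix k (m s) \<and> m u k \<noteq> m s k \<and>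
    (\<forall>v\<in>{v \<in> V. key u < key v \<and> key v \<le> key t}.
      vec_prefix (Suc k) (m v) \<noteq> vec_prefix (Suc k) (m s))"
proof -
  obtain l where l: "search_state V key m s t u l"
    using assms(7) by (auto simp: passes_through_def)
  have u: "\<forall>i<l. m u i = m s i"
    and unvisited: "\<And>v. v \<in> V \<Longrightarrow> key u < key v \<Longrightarrow> key v \<le> key t \<Longrightarrow>
      vec_prefix (Suc l) (m v) \<noteq> vec_prefix (Suc l) (m s)"
    using search_state_unvisited[OF assms(1-3) _ l] isolated
    by (auto simp flip: vec_prefix_eq_iff)
  define k where "k = (LEAST i. m u i \<noteq> m s i)"
  obtain i where i: "i < K" "m u i \<noteq> m s i"
    using isolated assms(4,5) by (auto simp: vec_prefix_eq_iff)
  have k: "m u k \<noteq> m s k"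
    unfolding k_def by (rule LeastI[of _ i]) (rule i)
  have agree: "m u j = m s j" if "j < k" for j
    using not_less_Least that unfolding k_def by blast
  have "k \<le> i"
    unfolding k_def by (rule Least_le) (rule i)
  moreover have "l \<le> k"
    using u k by (metis not_less)
  then have "vec_prefix (Suc k) (m v) \<noteq> vec_prefix (Suc k) (m s)"
    if "v \<in> V" "key u < key v" "key v \<le> key t" for v
    using unvisited[OF that] that unfolding vec_prefix_eq_iff
    by (meson Suc_le_mono less_le_trans)
  ultimately show ?thesis
    using k agree i(1) by (intro exI[of _ k]) (auto simp: vec_prefix_eq_iff)
qed

section \<open>Prefixes of independent uniform bit sequences\<close>

text \<open>Distinct nodes use disjoint blocks \<open>{x} \<times> {..<n}\<close> of bits, so
  grouping preserves independence. Measurability is automatic because a finite product of these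
  count spaces is again a count space.\<close>

lemma (in prob_space) indep_vars_vec_prefix:
  assumes "indep_vars (\<lambda>_. count_space UNIV) (\<lambda>(x, i) \<omega>. m \<omega> x i) (V \<times> UNIV)"
  shows "indep_vars (\<lambda>_. count_space UNIV) (\<lambda>x \<omega>. vec_prefix n (m \<omega> x)) V"
proof -
  let ?X = "\<lambda>(x, i) \<omega>. m \<omega> x i"
  let ?f = "\<lambda>x g. vec_prefix n (\<lambda>i. g (x, i))"
  have "indep_vars (\<lambda>x. PiM ({x} \<times> {..<n}) (\<lambda>_. count_space UNIV))
      (\<lambda>x \<omega>. restrict (\<lambda>j. ?X j \<omega>) ({x} \<times> {..<n})) V"
    by (intro indep_vars_restrict[OF assms]) (auto simp: disjoint_family_on_def)
  moreover have "?f x \<in> PiM ({x} \<times> {..<n}) (\<lambda>_. count_space UNIV) \<rightarrow>\<^sub>M count_space UNIV" for x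
    by (simp add: count_space_PiM_finite)
  ultimately have "indep_vars (\<lambda>_. count_space UNIV)
      (\<lambda>x \<omega>. ?f x (restrict (\<lambda>j. ?X j \<omega>) ({x} \<times> {..<n}))) V"
    by (rule indep_vars_compose2)
  moreover have "?f x (restrict (\<lambda>j. ?X j \<omega>) ({x} \<times> {..<n})) = vec_prefix n (m \<omega> x)" for x \<omega>
    by (simp add: vec_prefix_def)
  ultimately show ?thesis
    by simp
qed

lemma (in prob_space) prob_vec_prefix:
  assumes "indep_vars (\<lambda>_. count_space UNIV) (\<lambda>(x, i) \<omega>. m \<omega> x i) (V \<times> UNIV)"
    and half: "\<And>x i. x \<in> V \<Longrightarrow> \<P>(\<omega> in M. m \<omega> x i) = 1 / 2"
    and "x \<in> V" "length w = n"
  shows "prob ((\<lambda>\<omega>. vec_prefix n (m \<omega> x)) -` {w} \<inter> space M) = (1 / 2) ^ n"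
\<comment> \<open>For \<open>n = 0\<close> the intersection over the bits would be empty, giving the
  universe instead of \<open>space M\<close>.\<close>
proof (cases "n = 0")
  case True
  then have "(\<lambda>\<omega>. vec_prefix n (m \<omega> x)) -` {w} \<inter> space M = space M"
    using assms(4) by (auto simp: vec_prefix_def)
  then show ?thesis
    using True by (simp add: prob_space)
next
  case False
  define X where "X = (\<lambda>(x, i) \<omega>. m \<omega> x i)"
  have indep: "indep_vars (\<lambda>_. count_space UNIV) X (V \<times> UNIV)"
    using assms(1) by (simp add: X_def)
  have bit: "prob (X (x, i) -` {b} \<inter> space M) = 1 / 2" for i b
  proof -
    have "random_variable (count_space UNIV) (X (x, i))"
      using indep assms(3) unfolding indep_vars_def by blast
    then have meas: "X (x, i) -` {True} \<inter> space M \<in> events"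
      by (rule measurable_sets) simp
    have eq: "X (x, i) -` {True} \<inter> space M = {\<omega> \<in> space M. m \<omega> x i}"
      by (auto simp: X_def)
    then have prob_True: "prob (X (x, i) -` {True} \<inter> space M) = 1 / 2"
      using half[OF assms(3)] by simp
    have "X (x, i) -` {False} \<inter> space M = space M - (X (x, i) -` {True} \<inter> space M)"
      by auto
    then have "prob (X (x, i) -` {False} \<inter> space M) = 1 / 2"
      using prob_compl[OF meas] prob_True by simp
    then show ?thesis
      using prob_True by (cases b) auto
  qed
  have prefix_iff: "vec_prefix n f = w \<longleftrightarrow> (\<forall>i<n. f i = w ! i)" for f
    using assms(4) by (simp add: vec_prefix_def list_eq_iff_nth_eq)
  have "(\<lambda>\<omega>. vec_prefix n (m \<omega> x)) -` {w} \<inter> space M =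
      (\<Inter>j\<in>{x} \<times> {..<n}. X j -` {w ! snd j} \<inter> space M)"
  proof (rule set_eqI)
    fix \<omega>
    show "\<omega> \<in> (\<lambda>\<omega>. vec_prefix n (m \<omega> x)) -` {w} \<inter> space M \<longleftrightarrow>
        \<omega> \<in> (\<Inter>j\<in>{x} \<times> {..<n}. X j -` {w ! snd j} \<inter> space M)"
      using False by (auto simp: prefix_iff X_def)
  qed
  also have "prob \<dots> = (\<Prod>j\<in>{x} \<times> {..<n}. prob (X j -` {w ! snd j} \<inter> space M))"
    by (rule indep_varsD[OF indep, of "{x} \<times> {..<n}" "\<lambda>j. {w ! snd j}"])
      (use False assms(3) in auto)
  also have "\<dots> = (\<Prod>j\<in>{x} \<times> {..<n}. 1 / 2)"
    using bit by (intro prod.cong refl) auto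
  also have "\<dots> = (1 / 2) ^ n"
    by (simp add: card_cartesian_product)
  finally show ?thesis .
qed

text \<open>The prefix of \<open>s\<close> is random, so the admissible sets move with it. Fixing it
  to be \<open>w\<close> gives product events of equal probability, since only the cardinality
  \<open>b x\<close> enters and it does not depend on \<open>w\<close>. The \<open>2 ^ n\<close>
  choices of \<open>w\<close> cancel the factor \<open>(1 / 2) ^ n\<close> contributed by
  \<open>s\<close>.\<close>

lemma (in prob_space) prob_relative_prefixes:
  fixes V :: "'n set" and B :: "bool list \<Rightarrow> 'n \<Rightarrow> bool list set" and b :: "'n \<Rightarrow> nat"
  assumes "finite V"
    and "indep_vars (\<lambda>_. count_space UNIV) (\<lambda>(x, i) \<omega>. m \<omega> x i) (V \<times> UNIV)"
    and "\<And>x i. x \<in> V \<Longrightarrow> \<P>(\<omega> in M. m \<omega> x i) = 1 / 2"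
    and "s \<in> V" "W \<subseteq> V" "s \<notin> W"
    and B: "\<And>w x. length w = n \<Longrightarrow> x \<in> W \<Longrightarrow> B w x \<subseteq> {w. length w = n} \<and> card (B w x) = b x"
  defines "A \<equiv> {\<omega> \<in> space M. \<forall>x\<in>W. vec_prefix n (m \<omega> x) \<in> B (vec_prefix n (m \<omega> s)) x}"
  shows "A \<in> events" and "prob A = (\<Prod>x\<in>W. b x * (1 / 2) ^ n)"
proof -
  define L where "L = {w :: bool list. length w = n}"
  define Y where "Y x \<omega> = vec_prefix n (m \<omega> x)" for x \<omega>
  \<comment> \<open>The prefix of \<open>s\<close> becomes one more coordinate condition, so
    independence is applied to \<open>insert s W\<close>, which is nonempty even if \<open>W\<close>
    is empty.\<close>
  define C where "C w x = (if x = s then {w} else B w x)" for w x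
  define E where "E w = (\<Inter>x\<in>insert s W. Y x -` C w x \<inter> space M)" for w
  have W: "finite W"
    using assms(1,5) finite_subset by blast
  have L: "finite L" "card L = 2 ^ n"
    using finite_lists_length_eq[of "UNIV :: bool set" n] card_lists_length_eq[of "UNIV :: bool set" n]
    by (simp_all add: L_def)
  have indep: "indep_vars (\<lambda>_. count_space UNIV) Y V"
    unfolding Y_def[abs_def] by (rule indep_vars_vec_prefix) fact
  have Y_events: "Y x -` D \<inter> space M \<in> events" if "x \<in> V" for x D
    using indep that by (auto simp: indep_vars_def)
  have prob_Y: "prob (Y x -` D \<inter> space M) = card D * (1 / 2) ^ n" if "x \<in> V" "D \<subseteq> L" for x D
  proof -
    have "finite D"
      using L(1) that(2) finite_subset by blast
    have "Y x -` D \<inter> space M = (\<Union>w\<in>D. Y x -` {w} \<inter> space M)"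
      by auto
    also have "prob \<dots> = (\<Sum>w\<in>D. prob (Y x -` {w} \<inter> space M))"
      using \<open>finite D\<close> Y_events that(1)
      by (intro finite_measure_finite_Union) (auto simp: disjoint_family_on_def)
    also have "\<dots> = (\<Sum>w\<in>D. (1 / 2) ^ n)"
      unfolding Y_def[abs_def] using that
      by (intro sum.cong refl prob_vec_prefix[OF assms(2,3)]) (auto simp: L_def)
    finally show ?thesis
      by simp
  qed
  have E_events: "E w \<in> events" for w
    unfolding E_def using W assms(4,5) Y_events by (intro sets.finite_INT) auto
  have prob_E: "prob (E w) = (1 / 2) ^ n * (\<Prod>x\<in>W. b x * (1 / 2) ^ n)" if "w \<in> L" for w
  proof -
    have "prob (E w) = (\<Prod>x\<in>insert s W. prob (Y x -` C w x \<inter> space M))"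
      unfolding E_def using W assms(4,5)
      by (intro indep_varsD[OF indep, of "insert s W" "C w"]) auto
    also have "\<dots> = (\<Prod>x\<in>insert s W. card (C w x) * (1 / 2) ^ n)"
      using B that assms(4,5) by (intro prod.cong refl prob_Y) (auto simp: C_def L_def)
    also have "\<dots> = (1 / 2) ^ n * (\<Prod>x\<in>W. card (C w x) * (1 / 2) ^ n)"
      using W assms(6) by (simp add: C_def)
    also have "(\<Prod>x\<in>W. card (C w x) * (1 / 2) ^ n) = (\<Prod>x\<in>W. b x * (1 / 2 :: real) ^ n)"
      using B that assms(6) by (intro prod.cong refl) (auto simp: C_def L_def)
    finally show ?thesis .
  qed
  have A_eq: "A = (\<Union>w\<in>L. E w)"
  proof (rule set_eqI)
    fix \<omega>
    show "\<omega> \<in> A \<longleftrightarrow> \<omega> \<in> (\<Union>w\<in>L. E w)"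
      using assms(6) by (auto simp: A_def E_def C_def Y_def L_def split: if_splits)
  qed
  show "A \<in> events"
    unfolding A_eq using E_events L(1) by blast
  have "disjoint_family_on E L"
    by (auto simp: disjoint_family_on_def E_def C_def)
  then have "prob A = (\<Sum>w\<in>L. prob (E w))"
    unfolding A_eq using E_events L(1) by (intro finite_measure_finite_Union) auto
  also have "\<dots> = 2 ^ n * (1 / 2) ^ n * (\<Prod>x\<in>W. b x * (1 / 2) ^ n)"
    using prob_E L(2) by simp
  also have "2 ^ n * (1 / 2 :: real) ^ n = 1"
    by (simp add: power_one_over)
  finally show "prob A = (\<Prod>x\<in>W. b x * (1 / 2) ^ n)"
    by simp
qed

text \<open>Serves a union bound showing that a high level is unlikely not to isolate
  \<open>s\<close>.\<close>

lemma (in prob_space) prob_same_prefix: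
  assumes "finite V"
    and "indep_vars (\<lambda>_. count_space UNIV) (\<lambda>(x, i) \<omega>. m \<omega> x i) (V \<times> UNIV)"
    and "\<And>x i. x \<in> V \<Longrightarrow> \<P>(\<omega> in M. m \<omega> x i) = 1 / 2"
    and "s \<in> V" "u \<in> V" "s \<noteq> u"
  defines "A \<equiv> \<lambda>n. {\<omega> \<in> space M. vec_prefix n (m \<omega> u) = vec_prefix n (m \<omega> s)}"
  shows "A n \<in> events" and "prob (A n) = (1 / 2) ^ n"
  using prob_relative_prefixes[OF assms(1-4), of "{u}" n "\<lambda>w _. {w}" "\<lambda>_. 1"] assms(5,6)
  by (simp_all add: A_def)

text \<open>Prefixes of length \<open>Suc k\<close> decide the event. Given that of
  \<open>s\<close>, exactly one is admissible for \<open>u\<close>, namely the same word with its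
  last bit flipped, and all but one are admissible for each node of \<open>W\<close>.\<close>

lemma (in prob_space) prob_first_disagreement:
  assumes "finite V"
    and "indep_vars (\<lambda>_. count_space UNIV) (\<lambda>(x, i) \<omega>. m \<omega> x i) (V \<times> UNIV)"
    and "\<And>x i. x \<in> V \<Longrightarrow> \<P>(\<omega> in M. m \<omega> x i) = 1 / 2"
    and "s \<in> V" "u \<in> V" "W \<subseteq> V" "s \<noteq> u" "s \<notin> W" "u \<notin> W"
  defines "A \<equiv> \<lambda>k. {\<omega> \<in> space M. vec_prefix k (m \<omega> u) = vec_prefix k (m \<omega> s) \<and>
      m \<omega> u k \<noteq> m \<omega> s k \<and> (\<forall>v\<in>W. vec_prefix (Suc k) (m \<omega> v) \<noteq> vec_prefix (Suc k) (m \<omega> s))}"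
  shows "A k \<in> events"
    and "prob (A k) = (1 / 2) ^ Suc k * (1 - (1 / 2) ^ Suc k) ^ card W"
proof -
  define n where "n = Suc k"
  define L where "L = {w :: bool list. length w = n}"
  define flip where "flip w = w[k := \<not> w ! k]" for w
  define B where "B w x = (if x = u then {flip w} else L - {w})" for w x
  define b where "b x = (if x = u then 1 else 2 ^ n - 1 :: nat)" for x
  have L: "finite L" "card L = 2 ^ n"
    using finite_lists_length_eq[of "UNIV :: bool set" n] card_lists_length_eq[of "UNIV :: bool set" n]
    by (simp_all add: L_def)
  have "finite W"
    using assms(1,6) finite_subset by blast
  have B: "B w x \<subseteq> {w. length w = n} \<and> card (B w x) = b x" if "length w = n" for w x
    using that L by (auto simp: B_def b_def flip_def L_def)
  have flip_iff: "vec_prefix n f = flip (vec_prefix n g) \<longleftrightarrow> vec_prefix k f = vec_prefix k g \<and> f k \<noteq> g k"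
    for f g
  proof -
    have "flip (vec_prefix n g) = vec_prefix k g @ [\<not> g k]"
      by (simp add: flip_def n_def vec_prefix_def list_update_append nth_append)
    moreover have "vec_prefix n f = vec_prefix k f @ [f k]"
      by (simp add: n_def vec_prefix_def)
    ultimately show ?thesis
      by auto
  qed
  have A_eq: "A k = {\<omega> \<in> space M. \<forall>x\<in>insert u W. vec_prefix n (m \<omega> x) \<in> B (vec_prefix n (m \<omega> s)) x}"
  proof (rule set_eqI)
    fix \<omega>
    have "(\<forall>v\<in>W. vec_prefix n (m \<omega> v) \<noteq> vec_prefix n (m \<omega> s)) \<longleftrightarrow>
        (\<forall>v\<in>W. vec_prefix n (m \<omega> v) \<in> B (vec_prefix n (m \<omega> s)) v)"
      using assms(9) by (auto simp: B_def L_def)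
    then show "\<omega> \<in> A k \<longleftrightarrow>
        \<omega> \<in> {\<omega> \<in> space M. \<forall>x\<in>insert u W. vec_prefix n (m \<omega> x) \<in> B (vec_prefix n (m \<omega> s)) x}"
      by (simp add: A_def B_def flip_iff n_def[symmetric])
  qed
  note prob_A = prob_relative_prefixes[OF assms(1-4), of "insert u W" n B b]
  show "A k \<in> events"
    unfolding A_eq using prob_A(1) B assms(5-8) by simp
  have "prob (A k) = (\<Prod>x\<in>insert u W. b x * (1 / 2) ^ n)"
    unfolding A_eq using prob_A(2) B assms(5-8) by simp
  also have "\<dots> = (1 / 2) ^ n * (\<Prod>x\<in>W. b x * (1 / 2) ^ n)"
    using \<open>finite W\<close> assms(9) by (simp add: b_def)
  also have "(\<Prod>x\<in>W. b x * (1 / 2) ^ n) = (\<Prod>x\<in>W. 1 - (1 / 2 :: real) ^ n)"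
    using assms(9)
    by (intro prod.cong refl) (auto simp: b_def of_nat_diff power_one_over field_simps)
  finally show "prob (A k) = (1 / 2) ^ Suc k * (1 - (1 / 2) ^ Suc k) ^ card W"
    by (simp add: n_def)
qed

section \<open>Summing over the levels\<close>

text \<open>The tangent at \<open>b\<close> lies below the convex function \<open>x ^ Suc d\<close>.
  This replaces the integral estimate for a single level; the induction drops the quadratic term in
  \<open>h\<close>.\<close>

lemma power_Suc_diff_ge:
  fixes b h :: real
  assumes "0 \<le> b" "0 \<le> h"
  shows "real (Suc d) * h * b ^ d \<le> (b + h) ^ Suc d - b ^ Suc d"
proof (induction d)
  case (Suc d)
  have "(b + h) * (b ^ Suc d + real (Suc d) * h * b ^ d) \<le> (b + h) * (b + h) ^ Suc d"
    using Suc assms by (intro mult_left_mono) auto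
  moreover have "(b + h) * (b ^ Suc d + real (Suc d) * h * b ^ d) =
      b ^ Suc (Suc d) + real (Suc (Suc d)) * h * b ^ Suc d + real (Suc d) * h\<^sup>2 * b ^ d"
    by (simp add: algebra_simps power2_eq_square)
  moreover have "0 \<le> real (Suc d) * h\<^sup>2 * b ^ d"
    using assms by simp
  ultimately show ?case
    by simp
qed simp

lemma sum_halves_le:
  "(\<Sum>k<K. (1 / 2) ^ Suc k * (1 - (1 / 2) ^ Suc k) ^ d)
    \<le> 2 / (real d + 1) * (1 - (1 / 2 :: real) ^ Suc d)"
proof -
  \<comment> \<open>\<open>a k / (d + 1)\<close> is minus an antiderivative of
    \<open>(1 - x) ^ d\<close> at \<open>x = (1 / 2) ^ Suc k\<close>, so the integrals over the
    halving intervals become telescoping differences.\<close>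
  define a where "a k = (1 - (1 / 2 :: real) ^ Suc k) ^ Suc d" for k
  have "(1 / 2) ^ Suc k * (1 - (1 / 2) ^ Suc k) ^ d \<le> 2 / (real d + 1) * (a (Suc k) - a k)" for k
  proof -
    define q :: real where "q = (1 / 2) ^ Suc k"
    \<comment> \<open>Since \<open>q\<close> halves from one level to the next, the step
      \<open>h = q / 2\<close> leads from the base \<open>1 - q\<close> of \<open>a k\<close> to
      that of \<open>a (Suc k)\<close>. Having \<open>q / 2\<close> in place of \<open>q\<close>
      costs the factor 2.\<close>
    have "real (Suc d) * (q / 2) * (1 - q) ^ d \<le> (1 - q + q / 2) ^ Suc d - (1 - q) ^ Suc d"
      using power_le_one[of "1 / 2 :: real" "Suc k"]
      by (intro power_Suc_diff_ge) (simp_all add: q_def)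
    also have "\<dots> = a (Suc k) - a k"
      by (simp add: a_def q_def)
    finally have "q * (1 - q) ^ d \<le> 2 / (real d + 1) * (a (Suc k) - a k)"
      by (simp add: field_simps)
    then show ?thesis
      by (simp only: q_def)
  qed
  then have "(\<Sum>k<K. (1 / 2) ^ Suc k * (1 - (1 / 2) ^ Suc k) ^ d)
      \<le> (\<Sum>k<K. 2 / (real d + 1) * (a (Suc k) - a k))"
    by (rule sum_mono)
  also have "\<dots> = 2 / (real d + 1) * (a K - a 0)"
    by (simp only: sum_lessThan_telescope flip: sum_distrib_left)
  \<comment> \<open>Bounding \<open>a K\<close> by 1 makes the estimate uniform in \<open>K\<close>;
    keeping \<open>a 0 = (1 / 2) ^ Suc d\<close> leaves it strictly below
    \<open>2 / (d + 1)\<close>.\<close>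
  also have "\<dots> \<le> 2 / (real d + 1) * (1 - (1 / 2) ^ Suc d)"
  proof -
    have "a K \<le> 1"
      unfolding a_def using power_le_one[of "1 / 2 :: real" "Suc K"]
      by (intro power_le_one) simp_all
    then show ?thesis
      by (intro mult_left_mono) (simp_all add: a_def)
  qed
  finally show ?thesis .
qed

theorem theorem5:
  fixes M :: "'w measure"
    and V :: "'n set"
    and key :: "'n \<Rightarrow> 'k::linorder"
    and m :: "'w \<Rightarrow> 'n \<Rightarrow> nat \<Rightarrow> bool"
    and s t u :: 'n
    and d :: nat
  assumes "prob_space M"
    and "finite V"
    and "inj_on key V"
    and "prob_space.indep_vars M (\<lambda>_. count_space UNIV) (\<lambda>(x, i) \<omega>. m \<omega> x i) (V \<times> UNIV)"
    and "\<And>x i. x \<in> V \<Longrightarrow> \<P>(\<omega> in M. m \<omega> x i) = 1 / 2"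
    and "s \<in> V" and "t \<in> V" and "u \<in> V"
    and "key s < key u" and "key u < key t"
    and "d = card {v \<in> V. key u < key v \<and> key v \<le> key t}"
  shows "\<P>(\<omega> in M. passes_through V key (m \<omega>) s t u) < 2 / (real d + 1)"
proof -
  interpret prob_space M by fact
  let ?P = "{\<omega> \<in> space M. passes_through V key (m \<omega>) s t u}"
  define W where "W = {v \<in> V. key u < key v \<and> key v \<le> key t}"
  define A where "A k = {\<omega> \<in> space M. vec_prefix k (m \<omega> u) = vec_prefix k (m \<omega> s) \<and>
      m \<omega> u k \<noteq> m \<omega> s k \<and> (\<forall>v\<in>W. vec_prefix (Suc k) (m \<omega> v) \<noteq> vec_prefix (Suc k) (m \<omega> s))}" for k
  define B where "B n x = {\<omega> \<in> space M. vec_prefix n (m \<omega> x) = vec_prefix n (m \<omega> s)}" for n x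
  have "W \<subseteq> V" "s \<noteq> u" "s \<notin> W" "u \<notin> W"
    using assms(9) by (auto simp: W_def)
  note A = prob_first_disagreement[OF assms(2,4,5,6,8) this, folded A_def]
  have B: "B n x \<in> events" "prob (B n x) = (1 / 2) ^ n" if "x \<in> V - {s}" for n x
    using prob_same_prefix[OF assms(2,4,5,6), of x n] that by (auto simp: B_def)
  \<comment> \<open>A limit in \<open>K\<close> only preserves non-strict inequalities, so the gap
    to \<open>2 / (d + 1)\<close> is built into \<open>c\<close>.\<close>
  define c where "c = 2 / (real d + 1) * (1 - (1 / 2) ^ Suc d)"
  \<comment> \<open>The second union contains the outcomes in which level \<open>K\<close> does not isolate \<open>s\<close>. An upper bound
    needs no measurability of \<open>?P\<close>, since non-measurable sets have measure \<open>0\<close>.\<close>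
  have cover: "?P \<subseteq> (\<Union>k<K. A k) \<union> (\<Union>x\<in>V - {s}. B K x)" for K
  proof
    fix \<omega>
    assume \<omega>: "\<omega> \<in> ?P"
    show "\<omega> \<in> (\<Union>k<K. A k) \<union> (\<Union>x\<in>V - {s}. B K x)"
    proof (cases "\<forall>x\<in>V - {s}. vec_prefix K (m \<omega> x) \<noteq> vec_prefix K (m \<omega> s)")
      case True
      then obtain k where "k < K" "vec_prefix k (m \<omega> u) = vec_prefix k (m \<omega> s)" "m \<omega> u k \<noteq> m \<omega> s k"
        "\<forall>v\<in>W. vec_prefix (Suc k) (m \<omega> v) \<noteq> vec_prefix (Suc k) (m \<omega> s)"
        using passes_through_agreement[OF assms(2,3,6,8) \<open>s \<noteq> u\<close>[symmetric] True, of t] \<omega>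
        unfolding W_def by blast
      then show ?thesis
        using \<omega> by (auto simp: A_def)
    next
      case False
      then show ?thesis
        using \<omega> by (auto simp: B_def)
    qed
  qed
  have "prob ?P \<le> c + card (V - {s}) * (1 / 2) ^ K" for K
  proof -
    have A_events: "(\<Union>k<K. A k) \<in> events" "A ` {..<K} \<subseteq> events"
      using A(1) by blast+
    have B_events: "(\<Union>x\<in>V - {s}. B K x) \<in> events" "B K ` (V - {s}) \<subseteq> events"
      using B(1) assms(2) by (blast intro: sets.finite_UN)+
    have "prob ?P \<le> prob ((\<Union>k<K. A k) \<union> (\<Union>x\<in>V - {s}. B K x))"
      using A_events B_events by (intro finite_measure_mono cover) auto
    also have "\<dots> \<le> prob (\<Union>k<K. A k) + prob (\<Union>x\<in>V - {s}. B K x)"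
      using A_events B_events by (intro measure_Un_le) auto
    also have "\<dots> \<le> (\<Sum>k<K. prob (A k)) + (\<Sum>x\<in>V - {s}. prob (B K x))"
      using A_events B_events assms(2) by (intro add_mono finite_measure_subadditive_finite) auto
    also have "\<dots> \<le> c + card (V - {s}) * (1 / 2) ^ K"
    proof (rule add_mono)
      show "(\<Sum>k<K. prob (A k)) \<le> c"
        using sum_halves_le[of d K] assms(11) by (simp only: A(2) c_def W_def)
      show "(\<Sum>x\<in>V - {s}. prob (B K x)) \<le> card (V - {s}) * (1 / 2) ^ K"
        by (simp only: B(2) sum_constant order.refl cong: sum.cong)
    qed
    finally show ?thesis .
  qed
  \<comment> \<open>As \<open>K\<close> grows, the contribution of the outcomes in which
    \<open>s\<close> is not isolated vanishes, while \<open>c\<close> stays fixed.\<close>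
  moreover have "(\<lambda>K. c + card (V - {s}) * (1 / 2) ^ K) \<longlonglongrightarrow> c + real (card (V - {s})) * 0"
    by (intro tendsto_add tendsto_mult tendsto_const LIMSEQ_power_zero) simp
  ultimately have "prob ?P \<le> c"
    by (intro LIMSEQ_le_const) auto
  also have "c < 2 / (real d + 1) * 1"
    unfolding c_def by (intro mult_strict_left_mono) simp_all
  finally show ?thesis
    by simp
qed

end
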